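(* Let $n\ge 1$ and let $P$ be a complex polynomial of degree $n$ such that $\Gamma=\{z\in\mathbb C: |P(z)|=1\}$ is a proper lemniscate of degree $n$. Let $\Omega_-=\{z\in\mathbb C:|P(z)|<1\}$ be the interior of $\Gamma$, let $\Phi_-:\mathbb D\to\Omega_-$ be a Riemann mapping, and let $\xi_1,\dots,\xi_n$ be the zeros of $P$ repeated according to multiplicity (these lie in $\Omega_-$). Then the fingerprint $k:\mathbb T\to\mathbb T$ of $\Gamma$ (the representative $k=\Phi_+^{-1}\circ\Phi_-|_{\mathbb T}$ determined by $\Phi_-$) is given by $k(z)=\sqrt[n]{B(z)}$, where $B$ is a Blaschke product $$B(z)=e^{i\theta}\prod_{j=1}^n\frac{z-a_j}{1-\overline{a_j}\,z},\qquad a_j=\Phi_-^{-1}(\xi_j),$$ for some $\theta\in\mathbb R$. That is, there is $\theta\in\mathbb R$ such that $k(z)^n=B(z)$ for all $z\in\mathbb T$.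
   Context: $\mathbb D=\{|z|<1\}$, $\mathbb T=\partial\mathbb D$, $\hat{\mathbb C}=\mathbb C\cup\{\infty\}$ is the Riemann sphere, and $\mathbb D_+=\hat{\mathbb C}\setminus\overline{\mathbb D}$. Proper lemniscate: for a polynomial $P$ of degree $n$, the lemniscate $\Gamma=\{z\in\mathbb C:|P(z)|=1\}$ is called a proper lemniscate of degree $n$ if it is smooth, meaning $P'(z)\neq0$ for all $z\in\Gamma$, and $\Omega_-=\{z\in\mathbb C:|P(z)|<1\}$ is connected. In that case $\Gamma$ is a smooth Jordan curve, $\Omega_-$ is simply connected and is the bounded component of $\mathbb C\setminus\Gamma$. Riemann mapping: a biholomorphic map $\Phi_-:\mathbb D\to\Omega_-$. Fingerprint: let $\Gamma\subset\mathbb C$ be a smooth Jordan curve, $\Omega_-$ the bounded component of $\mathbb C\setminus\Gamma$ and $\Omega_+=\hat{\mathbb C}\setminus\overline{\Omega_-}$. Let $\Phi_-:\mathbb D\to\Omega_-$ be any Riemann mapping and let $\Phi_+:\mathbb D_+\to\Omega_+$ be the unique conformal bijection with $\Phi_+(\infty)=\infty$ and $\Phi_+'(\infty)>0$, i.e. $\Phi_+(z)=az+\sum_{m\ge0}a_mz^{-m}$ near $\infty$ with $a>0$. Both maps extend to homeomorphisms of the closures, and $k=\Phi_+^{-1}\circ\Phi_-:\mathbb T\to\mathbb T$ is an orientation-preserving diffeomorphism. Changing $\Phi_-$ replaces $k$ by $k\circ\phi$ with $\phi$ a Möbius automorphism of $\mathbb D$; the fingerprint of $\Gamma$ is the class of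 $k$ modulo such right compositions, and one also calls any representative $k$ the fingerprint. The notation $k=\sqrt[n]{B}$ on $\mathbb T$ means that $k:\mathbb T\to\mathbb T$ is continuous and $k^n=B$ on $\mathbb T$. *)

theory Defs
  imports
    "HOL-Complex_Analysis.Complex_Analysis"
    "HOL-Computational_Algebra.Fundamental_Theorem_Algebra"
begin

definition lemniscate :: "complex poly \<Rightarrow> complex set" where
  "lemniscate P = {z. norm (poly P z) = 1}"

definition lemniscate_interior :: "complex poly \<Rightarrow> complex set" where
  "lemniscate_interior P = {z. norm (poly P z) < 1}"

definition proper_lemniscate :: "nat \<Rightarrow> complex poly \<Rightarrow> bool" where
  "proper_lemniscate n P \<longleftrightarrow>
     degree P = n \<and>
     (\<forall>z \<in> lemniscate P. poly (pderiv P) z \<noteq> 0) \<and>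
     connected (lemniscate_interior P)"

definition riemann_mapping :: "complex set \<Rightarrow> (complex \<Rightarrow> complex) \<Rightarrow> bool" where
  "riemann_mapping \<Omega> f \<longleftrightarrow>
     f holomorphic_on ball 0 1 \<and>
     bij_betw f (ball 0 1) \<Omega> \<and>
     inv_into (ball 0 1) f holomorphic_on \<Omega>"

text \<open>
  The conformal bijection from the exterior disc (including the point at infinity) onto the
  complement, in the Riemann sphere, of the closure of \<open>\<Omega>\<close>, normalised at infinity.
  Since infinity is sent to infinity, the map is given by its finite part \<open>F\<close>, a holomorphic
  bijection from \<open>- cball 0 1\<close> onto \<open>- closure \<Omega>\<close>; its behaviour at infinity
  is the expansion \<open>F z = a z + (\<Sum>m\<ge>0. c m / z ^ m)\<close> for large \<open>z\<close>, with
  \<open>a > 0\<close>.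
\<close>

definition exterior_mapping :: "complex set \<Rightarrow> (complex \<Rightarrow> complex) \<Rightarrow> bool" where
  "exterior_mapping \<Omega> F \<longleftrightarrow>
     F holomorphic_on (- cball 0 1) \<and>
     bij_betw F (- cball 0 1) (- closure \<Omega>) \<and>
     (\<exists>(a::real) c. a > 0 \<and>
        (\<forall>\<^sub>F z in at_infinity. (\<lambda>m. c m / z ^ m) sums (F z - of_real a * z)))"

text \<open>
  The values outside \<open>S\<close> of the continuous extension of \<open>f\<close> from \<open>S\<close> to
  \<open>closure S\<close>. (Values of \<open>f\<close> itself outside \<open>S\<close> are irrelevant.)
\<close>

definition boundary_values :: "complex set \<Rightarrow> (complex \<Rightarrow> complex) \<Rightarrow> complex \<Rightarrow> complex" where
  "boundary_values S f z = Lim (at z within S) f"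

text \<open>
  For a smooth Jordan curve \<open>\<Gamma>\<close> and a Riemann mapping \<open>\<Phi>m\<close> of its interior:
  \<open>k\<close> is the representative of the fingerprint of \<open>\<Gamma>\<close> determined by \<open>\<Phi>m\<close>.
  The set \<open>inside \<Gamma>\<close> is the bounded component of the complement of \<open>\<Gamma>\<close>.
  Only the values of \<open>k\<close> on the unit circle matter.
\<close>

definition is_fingerprint ::
    "complex set \<Rightarrow> (complex \<Rightarrow> complex) \<Rightarrow> (complex \<Rightarrow> complex) \<Rightarrow> bool" where
  "is_fingerprint \<Gamma> \<Phi>m k \<longleftrightarrow>
     (\<exists>\<Phi>p. exterior_mapping (inside \<Gamma>) \<Phi>p \<and>
        (\<forall>z \<in> sphere 0 1.
           k z = inv_into (sphere 0 1) (boundary_values (- cball 0 1) \<Phi>p)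
                   (boundary_values (ball 0 1) \<Phi>m z)))"

definition blaschke_product :: "nat \<Rightarrow> real \<Rightarrow> (nat \<Rightarrow> complex) \<Rightarrow> complex \<Rightarrow> complex" where
  "blaschke_product n \<theta> a z = cis \<theta> * (\<Prod>j = 1..n. (z - a j) / (1 - cnj (a j) * z))"

definition is_circle_root ::
    "nat \<Rightarrow> (complex \<Rightarrow> complex) \<Rightarrow> (complex \<Rightarrow> complex) \<Rightarrow> bool" where
  "is_circle_root n B k \<longleftrightarrow>
     continuous_on (sphere 0 1) k \<and>
     k ` sphere 0 1 \<subseteq> sphere 0 1 \<and>
     (\<forall>z \<in> sphere 0 1. k z ^ n = B z)"

end

theory Submission
  imports Defs
begin

text \<open>
  The polynomial \<open>P\<close> turns both conformal maps into explicit functions. The composition of \<open>P\<close> with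
  the interior map is holomorphic in the disc, its modulus tends to \<open>1\<close> at the circle, and its zeros
  are the points \<open>a j\<close>. Divided by the Blaschke product with these zeros it becomes a function without
  zeros whose modulus tends to \<open>1\<close> at the circle, that is, a unimodular constant
  (\<open>poly_comp_interior_eq_blaschke\<close>). In the same way the composition of \<open>P\<close> with the exterior map,
  which has no zeros and a pole of order \<open>n\<close> at infinity, is \<open>c * z ^ n\<close> with \<open>norm c = 1\<close>
  (\<open>poly_comp_exterior_mapping\<close>). On the circle the boundary value of the interior map at \<open>z\<close> is the
  boundary value of the exterior map at \<open>k z\<close>; applying \<open>P\<close> gives \<open>c * k z ^ n = B z\<close> for a
  Blaschke product \<open>B\<close>, and the constant \<open>c\<close> is absorbed into the rotation factor of \<open>B\<close>.

  The same two formulas provide the boundary values that define \<open>k\<close>. The right-hand sides are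
  continuous up to the circle, so near a boundary point the conformal maps take values close to a
  finite fibre of \<open>P\<close>, and by connectedness close to a single point of it (\<open>limit_of_poly_limit\<close>).
  The boundary map of the exterior is a bijection of the circle onto the lemniscate: surjective
  because every point of the curve is a limit of points with \<open>norm P > 1\<close>, and injective because
  \<open>P\<close> is locally injective along the smooth curve. Being a continuous bijection from a compact set, it
  is a homeomorphism, which makes \<open>k\<close> continuous.
\<close>

section \<open>Holomorphic functions with unimodular boundary values\<close>

text \<open>
  The maximum principle in the form where only the modulus has boundary values: extended by \<open>1\<close>
  to the circle, \<open>norm \<circ> f\<close> is continuous on the closed disc. If its maximum exceeded \<open>1\<close>, it would be attained inside, so \<open>f\<close> would be constant
  of modulus greater than \<open>1\<close>, against the boundary limit.
\<close>

lemma norm_le_1_of_boundary_norm_1: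
  assumes "f holomorphic_on ball 0 1"
    and lim: "\<And>\<zeta>. \<zeta> \<in> sphere 0 1 \<Longrightarrow> ((\<lambda>z. norm (f z)) \<longlongrightarrow> 1) (at \<zeta> within ball 0 1)"
    and "z \<in> ball 0 1"
  shows "norm (f z) \<le> 1"
proof (rule ccontr)
  assume gt: "\<not> norm (f z) \<le> 1"
  define u where "u = (\<lambda>z. if z \<in> ball 0 1 then norm (f z) else 1)"
  have ulim: "(u \<longlongrightarrow> u \<zeta>) (at \<zeta> within cball 0 1)" if \<zeta>: "\<zeta> \<in> cball 0 1" for \<zeta>
  proof (cases "\<zeta> \<in> ball 0 1")
    case True
    then have "isCont f \<zeta>"
      using assms(1) continuous_on_eq_continuous_at[of "ball 0 1" f] holomorphic_on_imp_continuous_on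
      by blast
    then have "((\<lambda>z. norm (f z)) \<longlongrightarrow> norm (f \<zeta>)) (at \<zeta>)"
      by (simp add: isCont_def tendsto_norm)
    then have "(u \<longlongrightarrow> norm (f \<zeta>)) (at \<zeta>)"
      by (rule Lim_transform_within_open[of _ _ _ _ "ball 0 1"]) (use True in \<open>auto simp: u_def\<close>)
    then show ?thesis
      using True by (simp add: u_def tendsto_within_subset[of _ _ _ UNIV])
  next
    case False
    with \<zeta> have "\<zeta> \<in> sphere 0 1" by auto
    have "cball 0 1 = ball 0 1 \<union> sphere (0::complex) 1" by auto
    moreover have "(u \<longlongrightarrow> 1) (at \<zeta> within ball 0 1)"
      by (rule Lim_transform_eventually[OF lim[OF \<open>\<zeta> \<in> sphere 0 1\<close>]])
         (auto simp: u_def eventually_at_filter)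
    moreover have "(u \<longlongrightarrow> 1) (at \<zeta> within sphere 0 1)"
      by (rule Lim_transform_eventually[OF tendsto_const])
         (auto simp: u_def eventually_at_filter)
    ultimately show ?thesis
      using False by (simp add: u_def Lim_within_Un)
  qed
  then have "continuous_on (cball 0 1) u"
    by (simp add: continuous_on_def)
  then obtain m where m: "m \<in> cball 0 1" "\<And>y. y \<in> cball 0 1 \<Longrightarrow> u y \<le> u m"
    using continuous_attains_sup[of "cball 0 1" u] by auto
  have "z \<in> cball 0 1" using assms(3) by auto
  have "u z > 1" using gt assms(3) by (simp add: u_def)
  then have um: "u m > 1" using m(2)[OF \<open>z \<in> cball 0 1\<close>] by linarith
  then have mb: "m \<in> ball 0 1" by (auto simp: u_def split: if_splits)
  have "f constant_on ball 0 1"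
  proof (rule maximum_modulus_principle[OF assms(1) _ _ _ _ mb])
    fix y :: complex assume "y \<in> ball 0 1"
    then show "norm (f y) \<le> norm (f m)"
      using m(2)[of y] mb by (auto simp: u_def)
  qed auto
  then have const: "\<And>y. y \<in> ball 0 1 \<Longrightarrow> f y = f m"
    using mb by (metis constant_on_def)
  have "((\<lambda>z. norm (f z)) \<longlongrightarrow> 1) (at 1 within ball 0 1)"
    by (rule lim) simp
  then have "((\<lambda>z::complex. norm (f m)) \<longlongrightarrow> 1) (at 1 within ball 0 1)"
    by (rule Lim_transform_eventually) (use const in \<open>auto simp: eventually_at_filter intro!: always_eventually\<close>)
  moreover have "at (1::complex) within ball 0 1 \<noteq> bot"
    using islimpt_ball[of "1::complex" 0 1] by (simp add: trivial_limit_within)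
  ultimately have "norm (f m) = 1"
    using tendsto_const_iff by fastforce
  then show False using um mb by (simp add: u_def)
qed

text \<open>
  The maximum principle applies to both \<open>f\<close> and \<open>1 / f\<close>, so \<open>norm \<circ> f\<close> is identically \<open>1\<close>.
\<close>

lemma constant_of_boundary_norm_1:
  assumes "f holomorphic_on ball 0 1"
    and nz: "\<And>z. z \<in> ball 0 1 \<Longrightarrow> f z \<noteq> 0"
    and lim: "\<And>\<zeta>. \<zeta> \<in> sphere 0 1 \<Longrightarrow> ((\<lambda>z. norm (f z)) \<longlongrightarrow> 1) (at \<zeta> within ball 0 1)"
  obtains c where "norm c = 1" "\<And>z. z \<in> ball 0 1 \<Longrightarrow> f z = c"
proof -
  have le: "norm (f z) \<le> 1" if "z \<in> ball 0 1" for z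
    using norm_le_1_of_boundary_norm_1[OF assms(1) lim that] .
  have "norm (inverse (f z)) \<le> 1" if "z \<in> ball 0 1" for z
  proof (rule norm_le_1_of_boundary_norm_1[OF _ _ that])
    show "(\<lambda>z. inverse (f z)) holomorphic_on ball 0 1"
      using assms(1) nz by (intro holomorphic_intros) auto
    show "((\<lambda>z. norm (inverse (f z))) \<longlongrightarrow> 1) (at \<zeta> within ball 0 1)" if "\<zeta> \<in> sphere 0 1" for \<zeta>
      using tendsto_inverse[OF lim[OF that]] by (simp add: norm_inverse)
  qed
  then have ge: "norm (f z) \<ge> 1" if "z \<in> ball 0 1" for z
    using nz[OF that] that by (fastforce simp: norm_inverse inverse_le_1_iff)
  have one: "norm (f z) = 1" if "z \<in> ball 0 1" for z
    using le[OF that] ge[OF that] by simp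
  have "f constant_on ball 0 1"
    by (rule maximum_modulus_principle[OF assms(1), where U = "ball 0 1" and \<xi> = 0])
       (use one in auto)
  then obtain c where "\<And>z. z \<in> ball 0 1 \<Longrightarrow> f z = c"
    by (auto simp: constant_on_def)
  moreover from this have "norm c = 1" using one[of 0] by simp
  ultimately show thesis using that by blast
qed

text \<open>
  An injective holomorphic map is proper onto its image: the inverse map is continuous and takes a
  compact subset of the image to a compact subset of the domain, which stays away from any point
  outside the domain.
\<close>

lemma eventually_avoids_compact:
  assumes "f holomorphic_on S" "open S" "inj_on f S"
    and "compact K" "K \<subseteq> f ` S" "\<zeta> \<notin> S"
  shows "\<forall>\<^sub>F z in at \<zeta> within S. f z \<notin> K"
proof -
  obtain g where g: "g holomorphic_on f ` S" "\<And>z. z \<in> S \<Longrightarrow> g (f z) = z"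
    using holomorphic_has_inverse[OF assms(1-3)] by metis
  have "compact (g ` K)"
    using compact_continuous_image[OF _ assms(4)] continuous_on_subset[OF _ assms(5)]
      holomorphic_on_imp_continuous_on[OF g(1)] by blast
  then have "open (- (g ` K))" by (simp add: compact_imp_closed open_Compl)
  moreover have "\<zeta> \<in> - (g ` K)" using assms(5,6) g(2) by auto
  ultimately have "\<forall>\<^sub>F z in at \<zeta> within S. z \<in> - (g ` K)"
    by (rule eventually_at_topological[THEN iffD2, OF exI, OF conjI, OF _ conjI]) auto
  moreover have "\<forall>\<^sub>F z in at \<zeta> within S. z \<in> S"
    by (auto simp: eventually_at_filter)
  ultimately show ?thesis
    by eventually_elim (use g(2) in force)
qed

section \<open>Sublevel sets of a polynomial\<close>

lemma compact_poly_sublevel: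
  fixes P :: "complex poly"
  assumes "degree P > 0"
  shows "compact {z. norm (poly P z) \<le> R}"
proof -
  have "\<forall>\<^sub>F z in at_infinity. norm (poly P z) \<ge> R + 1"
    using filterlim_at_infinity_imp_norm_at_top[OF filterlim_poly_at_infinity[OF assms]]
    by (simp add: filterlim_at_top)
  then obtain b where b: "\<And>z. norm z \<ge> b \<Longrightarrow> norm (poly P z) \<ge> R + 1"
    by (auto simp: eventually_at_infinity)
  have "{z. norm (poly P z) \<le> R} \<subseteq> cball 0 b"
  proof
    fix z assume "z \<in> {z. norm (poly P z) \<le> R}"
    then show "z \<in> cball 0 b" using b[of z] by (cases "norm z \<ge> b") auto
  qed
  then have "bounded {z. norm (poly P z) \<le> R}"
    using bounded_cball bounded_subset by blast
  moreover have "closed {z. norm (poly P z) \<le> R}"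
    by (intro closed_Collect_le continuous_intros)
  ultimately show ?thesis by (simp add: compact_eq_bounded_closed)
qed

lemma open_poly_image:
  fixes P :: "complex poly"
  assumes "degree P > 0" "open U"
  shows "open (poly P ` U)"
proof (rule open_mapping_thm[where S = UNIV])
  show "\<not> poly P constant_on UNIV"
    using assms(1) by (metis constant_def constant_degree constant_on_def UNIV_I less_irrefl)
qed (use assms in \<open>auto intro!: holomorphic_intros\<close>)

text \<open>
  Near a point of the curve the polynomial is open, hence takes values of modulus slightly below
  and slightly above \<open>1\<close>.
\<close>

lemma lemniscate_subset_closure:
  fixes P :: "complex poly"
  assumes deg: "degree P > 0" and w: "norm (poly P w) = 1"
  shows "w \<in> closure {z. norm (poly P z) < 1}" "w \<in> closure {z. norm (poly P z) > 1}"
proof -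
  \<comment> \<open>Both parts use a value of the form \<open>t * poly P w\<close>; the flag \<open>b\<close> selects \<open>t > 1\<close> or \<open>t < 1\<close>.\<close>
  have ex: "\<exists>y. dist y w < e \<and> (\<exists>t::real. poly P y = of_real t * poly P w \<and> (t > 1 \<longleftrightarrow> b) \<and> t \<noteq> 1 \<and> t > 0)"
    if "e > 0" for e and b :: bool
  proof -
    have "open (poly P ` ball w e)" by (rule open_poly_image[OF deg]) simp
    then obtain d where d: "d > 0" "ball (poly P w) d \<subseteq> poly P ` ball w e"
      using \<open>e > 0\<close> by (meson centre_in_ball imageI open_contains_ball)
    define s where "s = min (d / 2) (1 / 2)"
    define t where "t = (if b then 1 + s else 1 - s)"
    have s: "0 < s" "s < d" "s < 1" using d by (auto simp: s_def)
    have "dist (poly P w) (of_real t * poly P w) = norm ((1 - of_real t) * poly P w)"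
      by (simp add: dist_norm algebra_simps)
    also have "\<dots> = \<bar>1 - t\<bar>"
      using w by (metis mult.right_neutral norm_mult norm_of_real of_real_1 of_real_diff)
    also have "\<dots> < d" using s by (auto simp: t_def)
    finally have "of_real t * poly P w \<in> poly P ` ball w e" using d by auto
    then obtain y where "y \<in> ball w e" "poly P y = of_real t * poly P w" by auto
    moreover have "t > 1 \<longleftrightarrow> b" "t \<noteq> 1" "t > 0" using s by (auto simp: t_def)
    ultimately show ?thesis by (intro exI[of _ y]) (auto simp: dist_commute)
  qed
  show "w \<in> closure {z. norm (poly P z) < 1}"
    unfolding closure_approachable
  proof (intro allI impI)
    fix e :: real assume "e > 0"
    from ex[OF this, of False] obtain y t where "dist y w < e" "poly P y = of_real t * poly P w" "t < 1" "t > 0"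
      by force
    then show "\<exists>y\<in>{z. norm (poly P z) < 1}. dist y w < e"
      using w by (intro bexI[of _ y]) (auto simp: norm_mult)
  qed
  show "w \<in> closure {z. norm (poly P z) > 1}"
    unfolding closure_approachable
  proof (intro allI impI)
    fix e :: real assume "e > 0"
    from ex[OF this, of True] obtain y t where "dist y w < e" "poly P y = of_real t * poly P w" "t > 1"
      by force
    then show "\<exists>y\<in>{z. norm (poly P z) > 1}. dist y w < e"
      using w by (intro bexI[of _ y]) (auto simp: norm_mult)
  qed
qed

lemma closure_lemniscate_interior:
  assumes "degree P > 0"
  shows "closure (lemniscate_interior P) = {z. norm (poly P z) \<le> 1}"
proof
  show "closure (lemniscate_interior P) \<subseteq> {z. norm (poly P z) \<le> 1}"
    by (intro closure_minimal closed_Collect_le continuous_intros) (auto simp: lemniscate_interior_def)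
  show "{z. norm (poly P z) \<le> 1} \<subseteq> closure (lemniscate_interior P)"
    using lemniscate_subset_closure(1)[OF assms] closure_subset[of "lemniscate_interior P"]
    unfolding lemniscate_interior_def by (force simp: le_less)
qed

text \<open>
  A component of the complement that meets \<open>{norm P < 1}\<close> cannot leave it, by connectedness, and
  \<open>{norm P < 1}\<close> is bounded. Conversely, a bounded component has its frontier on the curve, so the
  maximum principle gives \<open>norm P \<le> 1\<close> on it.
\<close>

lemma inside_lemniscate:
  assumes deg: "degree P > 0"
  shows "inside (lemniscate P) = lemniscate_interior P"
proof (intro equalityI subsetI)
  fix x assume "x \<in> lemniscate_interior P"
  then have x: "norm (poly P x) < 1" by (simp add: lemniscate_interior_def)
  let ?C = "connected_component_set (- lemniscate P) x"
  have "?C \<subseteq> {z. norm (poly P z) \<le> 1}"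
  proof (rule ccontr)
    assume "\<not> ?thesis"
    then obtain y where y: "y \<in> ?C" "norm (poly P y) > 1" by force
    have "connected ((\<lambda>z. norm (poly P z)) ` ?C)"
      by (intro connected_continuous_image continuous_intros connected_connected_component)
    moreover have "norm (poly P x) \<in> (\<lambda>z. norm (poly P z)) ` ?C"
      using x by (intro imageI) (auto simp: lemniscate_def)
    ultimately have "1 \<in> (\<lambda>z. norm (poly P z)) ` ?C"
      using connectedD_interval[of "(\<lambda>z. norm (poly P z)) ` ?C" "norm (poly P x)" "norm (poly P y)" 1] x y
      by auto
    then show False
      using connected_component_subset[of "- lemniscate P" x] by (force simp: lemniscate_def)
  qed
  then have "bounded ?C"
    using compact_imp_bounded[OF compact_poly_sublevel[OF deg]] bounded_subset by blast
  then show "x \<in> inside (lemniscate P)" using x by (auto simp: inside_def lemniscate_def)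
next
  fix x assume x: "x \<in> inside (lemniscate P)"
  let ?C = "connected_component_set (- lemniscate P) x"
  have b: "bounded ?C" "x \<notin> lemniscate P" using x by (auto simp: inside_def)
  have "closed (lemniscate P)"
    unfolding lemniscate_def by (intro closed_Collect_eq continuous_intros)
  then have "frontier ?C \<subseteq> lemniscate P"
    using frontier_of_components_closed_complement[of "lemniscate P" ?C] b
    by (auto simp: componentsI)
  have "norm (poly P x) \<le> 1"
    by (rule maximum_modulus_frontier[of "poly P" ?C])
       (use b \<open>frontier ?C \<subseteq> _\<close> in \<open>auto intro!: holomorphic_intros continuous_intros simp: lemniscate_def\<close>)
  then show "x \<in> lemniscate_interior P"
    using b by (auto simp: lemniscate_interior_def lemniscate_def)
qed

section \<open>Boundary limits from finite fibres\<close>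

text \<open>
  Removing the \<open>e\<close>-neighbourhood of the fibre over \<open>b\<close> from a compact sublevel set leaves a compact
  set on which \<open>P - b\<close> has no zero, so it is bounded below there.
\<close>

lemma poly_near_value_imp_near_fibre:
  fixes P :: "complex poly"
  assumes deg: "degree P > 0" and "e > 0"
  obtains \<eta> where "\<eta> > 0" "\<And>x. norm (poly P x - b) < \<eta> \<Longrightarrow> \<exists>w. poly P w = b \<and> dist w x < e"
proof -
  define U where "U = (\<Union>w\<in>{w. poly P w = b}. ball w e)"
  define K where "K = {z. norm (poly P z) \<le> 1 + norm b} - U"
  have "compact K"
    unfolding K_def U_def by (intro compact_diff compact_poly_sublevel deg) auto
  have pos: "norm (poly P x - b) > 0" if "x \<in> K" for x
    using that \<open>e > 0\<close> by (force simp: K_def U_def)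
  obtain m where m: "m > 0" "\<And>x. x \<in> K \<Longrightarrow> m \<le> norm (poly P x - b)"
  proof (cases "K = {}")
    case True then show ?thesis using that[of 1] by simp
  next
    case False
    have "continuous_on K (\<lambda>x. norm (poly P x - b))" by (intro continuous_intros)
    from continuous_attains_inf[OF \<open>compact K\<close> False this] obtain x0
      where "x0 \<in> K" "\<forall>y\<in>K. norm (poly P x0 - b) \<le> norm (poly P y - b)" by blast
    then show ?thesis using that[of "norm (poly P x0 - b)"] pos by blast
  qed
  show thesis
  proof (rule that[of "min 1 m"])
    show "min 1 m > 0" using m by simp
    fix x assume x: "norm (poly P x - b) < min 1 m"
    have "norm (poly P x) \<le> 1 + norm b"
      using x norm_triangle_sub[of "poly P x" b] by simp
    moreover have "x \<notin> K" using m(2)[of x] x by auto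
    ultimately show "\<exists>w. poly P w = b \<and> dist w x < e" by (auto simp: K_def U_def)
  qed
qed

text \<open>
  This replaces Caratheodory's extension theorem. If \<open>P \<circ> f\<close> tends to \<open>b\<close> at a boundary point, then
  near that point \<open>f\<close> takes values near the finite fibre of \<open>P\<close> over \<open>b\<close>. Small neighbourhoods of
  the points of the fibre are disjoint, and the images of connected neighbourhoods in \<open>S\<close> are
  connected, so \<open>f\<close> stays near a single point of the fibre, its limit.
\<close>

lemma limit_of_poly_limit:
  fixes P :: "complex poly" and f :: "complex \<Rightarrow> complex"
  assumes deg: "degree P > 0"
    and contf: "continuous_on S f" and "\<zeta> islimpt S" "\<zeta> \<notin> S"
    and "r0 > 0" and conn: "\<And>r. \<lbrakk>0 < r; r \<le> r0\<rbrakk> \<Longrightarrow> connected (S \<inter> ball \<zeta> r)"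
    and lim: "((\<lambda>z. poly P (f z)) \<longlongrightarrow> b) (at \<zeta> within S)"
  obtains w where "poly P w = b" "(f \<longlongrightarrow> w) (at \<zeta> within S)"
proof -
  define Z where "Z = {w. poly P w = b}"
  have "Z = {w. poly (P - [:b:]) w = 0}" by (simp add: Z_def)
  moreover have "P - [:b:] \<noteq> 0" using deg by auto
  ultimately have "finite Z" using poly_roots_finite by metis
  obtain d where d: "d > 0" "\<And>v w. \<lbrakk>v \<in> Z; w \<in> Z; v \<noteq> w\<rbrakk> \<Longrightarrow> 2 * d \<le> dist v w"
  proof -
    define D where "D = insert 1 ((\<lambda>(v,w). dist v w) ` ({(v,w) \<in> Z \<times> Z. v \<noteq> w}))"
    have "finite {(v,w) \<in> Z \<times> Z. v \<noteq> w}"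
      by (rule finite_subset[of _ "Z \<times> Z"]) (use \<open>finite Z\<close> in auto)
    then have "finite D" by (simp add: D_def)
    have "Min D > 0" using \<open>finite D\<close> by (subst Min_gr_iff) (auto simp: D_def)
    moreover have "Min D \<le> dist v w" if "v \<in> Z" "w \<in> Z" "v \<noteq> w" for v w
      by (rule Min_le[OF \<open>finite D\<close>]) (use that in \<open>force simp: D_def\<close>)
    ultimately show thesis using that[of "Min D / 2"] by auto
  qed
  have near: "\<exists>r. 0 < r \<and> r \<le> r0 \<and> (\<forall>z\<in>S \<inter> ball \<zeta> r. \<exists>w\<in>Z. dist w (f z) < e)" if "e > 0" for e
  proof -
    obtain \<eta> where \<eta>: "\<eta> > 0" "\<And>x. norm (poly P x - b) < \<eta> \<Longrightarrow> \<exists>w. poly P w = b \<and> dist w x < e"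
      using poly_near_value_imp_near_fibre[OF deg \<open>e > 0\<close>] by blast
    have "\<forall>\<^sub>F z in at \<zeta> within S. dist (poly P (f z)) b < \<eta>"
      using lim \<eta>(1) by (rule tendstoD)
    then obtain r where r: "r > 0" "\<And>z. \<lbrakk>z \<in> S; z \<noteq> \<zeta>; dist z \<zeta> < r\<rbrakk> \<Longrightarrow> dist (poly P (f z)) b < \<eta>"
      by (auto simp: eventually_at)
    show ?thesis
    proof (intro exI[of _ "min r r0"] conjI ballI)
      fix z assume "z \<in> S \<inter> ball \<zeta> (min r r0)"
      then have "norm (poly P (f z) - b) < \<eta>"
        using r(2)[of z] \<open>\<zeta> \<notin> S\<close> by (auto simp: dist_norm norm_minus_commute)
      then show "\<exists>w\<in>Z. dist w (f z) < e" using \<eta>(2) by (auto simp: Z_def)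
    qed (use r \<open>r0 > 0\<close> in auto)
  qed
  from near[OF d(1)] obtain r1 where
    r1: "0 < r1" "r1 \<le> r0" "\<And>z. z \<in> S \<inter> ball \<zeta> r1 \<Longrightarrow> \<exists>w\<in>Z. dist w (f z) < d" by blast
  obtain z1 where z1: "z1 \<in> S \<inter> ball \<zeta> r1"
    using \<open>\<zeta> islimpt S\<close> r1(1) by (force simp: islimpt_approachable dist_commute)
  then obtain w where w: "w \<in> Z" "dist w (f z1) < d" using r1(3) by blast
  \<comment> \<open>The value at one point singles out the point \<open>w\<close> of the fibre; connectedness keeps all values near it.\<close>
  let ?V = "\<Union>v\<in>Z - {w}. ball v d"
  have "f ` (S \<inter> ball \<zeta> r1) \<subseteq> ball w d"
  proof -
    have "connected (f ` (S \<inter> ball \<zeta> r1))"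
      using conn[OF r1(1,2)] contf by (intro connected_continuous_image) (auto intro: continuous_on_subset)
    moreover have "f ` (S \<inter> ball \<zeta> r1) \<subseteq> ball w d \<union> ?V" using r1(3) by fastforce
    moreover have disj: "ball w d \<inter> ?V = {}"
    proof -
      have "ball w d \<inter> ball v d = {}" if "v \<in> Z - {w}" for v
        using d(2)[of v w] w that by (intro disjoint_ballI) (auto simp: dist_commute)
      then show ?thesis by blast
    qed
    ultimately have "ball w d \<inter> f ` (S \<inter> ball \<zeta> r1) = {} \<or> ?V \<inter> f ` (S \<inter> ball \<zeta> r1) = {}"
      using connectedD[of "f ` (S \<inter> ball \<zeta> r1)" "ball w d" ?V] by (auto intro: open_UN)
    then have "?V \<inter> f ` (S \<inter> ball \<zeta> r1) = {}" using z1 w by auto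
    then show ?thesis using \<open>f ` (S \<inter> ball \<zeta> r1) \<subseteq> ball w d \<union> ?V\<close> by blast
  qed
  have "(f \<longlongrightarrow> w) (at \<zeta> within S)"
  proof (rule tendstoI)
    fix e :: real assume "e > 0"
    then obtain r2 where r2: "0 < r2" "\<And>z. z \<in> S \<inter> ball \<zeta> r2 \<Longrightarrow> \<exists>w\<in>Z. dist w (f z) < min e d"
      using near[of "min e d"] d(1) by auto
    have "dist (f z) w < e" if z: "z \<in> S" "dist z \<zeta> < min r1 r2" for z
    proof -
      obtain v where v: "v \<in> Z" "dist v (f z) < min e d"
        using r2(2)[of z] z by (auto simp: dist_commute)
      have "f z \<in> ball w d" using \<open>f ` (S \<inter> ball \<zeta> r1) \<subseteq> ball w d\<close>
        by (rule subsetD) (use z in \<open>auto simp: dist_commute\<close>)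
      then have "dist v w < 2 * d" using v dist_triangle[of v w "f z"] by (simp add: dist_commute)
      then have "v = w" using d(2)[OF v(1) w(1)] by force
      then show ?thesis using v by (simp add: dist_commute)
    qed
    then show "\<forall>\<^sub>F z in at \<zeta> within S. dist (f z) w < e"
      unfolding eventually_at using r1(1) r2(1) by (intro exI[of _ "min r1 r2"]) auto
  qed
  then show thesis using that w(1) by (simp add: Z_def)
qed

text \<open>
  Pointwise boundary limits always form a continuous function, since each of them is
  approximated from the same values inside.
\<close>

lemma continuous_on_boundary_limits:
  fixes f :: "'a::metric_space \<Rightarrow> 'b::metric_space"
  assumes "\<And>z. z \<in> T \<Longrightarrow> (f \<longlongrightarrow> g z) (at z within S)" "\<And>z. z \<in> T \<Longrightarrow> z islimpt S"
  shows "continuous_on T g"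
  unfolding continuous_on_iff
proof (intro ballI allI impI)
  fix z and e :: real assume z: "z \<in> T" and "e > 0"
  then have "\<forall>\<^sub>F x in at z within S. dist (f x) (g z) < e / 2"
    using tendstoD[OF assms(1)[OF z], of "e / 2"] by simp
  then obtain d where d: "d > 0" "\<And>x. \<lbrakk>x \<in> S; x \<noteq> z; dist x z < d\<rbrakk> \<Longrightarrow> dist (f x) (g z) < e / 2"
    by (auto simp: eventually_at)
  have "dist (g y) (g z) < e" if y: "y \<in> T" "dist y z < d" for y
  proof (cases "y = z")
    case False
    have "\<forall>\<^sub>F x in at y within S. x \<in> ball z d - {z}"
      unfolding eventually_at_topological
      by (rule exI[of _ "ball z d - {z}"]) (use y False in \<open>auto simp: dist_commute\<close>)
    moreover have "\<forall>\<^sub>F x in at y within S. x \<in> S" by (auto simp: eventually_at_filter)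
    ultimately have "\<forall>\<^sub>F x in at y within S. dist (f x) (g z) \<le> e / 2"
      by eventually_elim (use d(2) in \<open>force simp: dist_commute\<close>)
    moreover have "((\<lambda>x. dist (f x) (g z)) \<longlongrightarrow> dist (g y) (g z)) (at y within S)"
      by (intro tendsto_intros assms y)
    ultimately have "dist (g y) (g z) \<le> e / 2"
      using tendsto_upperbound assms(2)[OF y(1)] by (metis trivial_limit_within)
    then show ?thesis using \<open>e > 0\<close> by simp
  qed (use \<open>e > 0\<close> in simp)
  then show "\<exists>d>0. \<forall>y\<in>T. dist y z < d \<longrightarrow> dist (g y) (g z) < e" using d(1) by blast
qed

section \<open>The interior: a Blaschke product\<close>

text \<open>
  On the unit circle \<open>z * cnj z = 1\<close>, so the denominator is \<open>z\<close> times the conjugate of the numerator.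
\<close>

lemma norm_blaschke_factor:
  fixes z a :: complex
  assumes "norm z = 1" "norm a < 1"
  shows "1 - cnj a * z \<noteq> 0" "norm ((z - a) / (1 - cnj a * z)) = 1"
proof -
  have "1 - cnj a * z = z * cnj (z - a)"
    using assms(1) complex_norm_square[of z] by (simp add: algebra_simps)
  then have "norm (1 - cnj a * z) = norm (z - a)"
    using assms(1) by (metis complex_mod_cnj mult_1 norm_mult)
  moreover have "z \<noteq> a" using assms by auto
  ultimately show "1 - cnj a * z \<noteq> 0" "norm ((z - a) / (1 - cnj a * z)) = 1"
    by (auto simp: norm_divide)
qed

lemma norm_blaschke_product:
  assumes "norm z = 1" "\<And>j. j \<in> {1..n} \<Longrightarrow> norm (a j) < 1"
  shows "norm (blaschke_product n \<theta> a z) = 1"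
proof -
  have "(\<Prod>j=1..n. norm ((z - a j) / (1 - cnj (a j) * z))) = 1"
    using norm_blaschke_factor(2)[of z] assms by (intro prod.neutral) auto
  then show ?thesis by (simp add: blaschke_product_def norm_mult prod_norm)
qed

lemma cnj_mult_neq_1:
  fixes z a :: complex
  assumes "norm z \<le> 1" "norm a < 1"
  shows "1 - cnj a * z \<noteq> 0"
proof -
  have "norm (cnj a * z) \<le> norm a"
    using assms(1) by (simp add: norm_mult mult_left_le)
  then have "norm (cnj a * z) < 1" using assms(2) by linarith
  then show ?thesis by auto
qed

lemma islimpt_unit_ball: "\<zeta> \<in> sphere 0 1 \<Longrightarrow> \<zeta> islimpt ball (0::complex) 1"
  using islimpt_ball[of \<zeta> 0 1] by auto

lemma poly_eq_lead_prod:
  fixes P :: "complex poly"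
  assumes "image_mset \<xi> (mset_set A) = proots P"
  shows "poly P x = lead_coeff P * (\<Prod>j\<in>A. x - \<xi> j)"
proof -
  have "poly P x = poly (smult (lead_coeff P) (\<Prod>y\<in>#proots P. [:-y, 1:])) x"
    by (simp only: complex_poly_decompose_multiset)
  also have "\<dots> = lead_coeff P * poly (\<Prod>j\<in>A. [:- \<xi> j, 1:]) x"
    by (simp add: assms[symmetric] multiset.map_comp comp_def prod_unfold_prod_mset)
  finally show ?thesis by (simp add: poly_prod)
qed

text \<open>
  Near the circle the values of \<open>f\<close> leave each compact set \<open>{norm P \<le> l}\<close>, \<open>l < 1\<close>, by properness.
\<close>

lemma interior_norm_tendsto_1:
  assumes deg: "degree P > 0" and f: "riemann_mapping (lemniscate_interior P) f"
    and \<zeta>: "\<zeta> \<in> sphere 0 1"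
  shows "((\<lambda>z. norm (poly P (f z))) \<longlongrightarrow> 1) (at \<zeta> within ball 0 1)"
proof -
  have hol: "f holomorphic_on ball 0 1" and inj: "inj_on f (ball 0 1)"
    and im: "f ` ball 0 1 = lemniscate_interior P"
    using f by (auto simp: riemann_mapping_def bij_betw_def)
  show ?thesis
  proof (rule order_tendstoI)
    fix l :: real assume "l < 1"
    then have "{z. norm (poly P z) \<le> l} \<subseteq> f ` ball 0 1"
      unfolding im by (auto simp: lemniscate_interior_def)
    then have "\<forall>\<^sub>F z in at \<zeta> within ball 0 1. f z \<notin> {z. norm (poly P z) \<le> l}"
      using \<zeta> by (intro eventually_avoids_compact[OF hol open_ball inj compact_poly_sublevel[OF deg]]) auto
    then show "\<forall>\<^sub>F z in at \<zeta> within ball 0 1. l < norm (poly P (f z))"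
      by eventually_elim auto
  next
    fix u :: real assume "1 < u"
    have "\<forall>\<^sub>F z in at \<zeta> within ball 0 1. z \<in> ball 0 1" by (auto simp: eventually_at_filter)
    then show "\<forall>\<^sub>F z in at \<zeta> within ball 0 1. norm (poly P (f z)) < u"
    proof eventually_elim
      case (elim z)
      then have "f z \<in> lemniscate_interior P" using im by blast
      then show ?case using \<open>1 < u\<close> by (simp add: lemniscate_interior_def)
    qed
  qed
qed

text \<open>
  Splitting \<open>P\<close> into linear factors reduces the division by the Blaschke product to one factor at a
  time: since \<open>f\<close> is injective, \<open>f z - f (a j)\<close> is \<open>z - a j\<close> times a holomorphic function without
  zeros, so multiplicities of zeros take care of themselves. The remaining quotient has no zeros
  and boundary modulus \<open>1\<close>, and therefore is constant.
\<close>

lemma poly_comp_interior_eq_blaschke: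
  assumes deg: "degree P > 0" and f: "riemann_mapping (lemniscate_interior P) f"
    and roots: "image_mset (\<lambda>j. f (a j)) (mset_set {1..n}) = proots P"
    and a: "\<And>j. j \<in> {1..n} \<Longrightarrow> a j \<in> ball 0 1"
  obtains \<theta> where "\<And>z. z \<in> ball 0 1 \<Longrightarrow> poly P (f z) = blaschke_product n \<theta> a z"
proof -
  have hol: "f holomorphic_on ball 0 1" and inj: "inj_on f (ball 0 1)"
    using f by (auto simp: riemann_mapping_def bij_betw_def)
  \<comment> \<open>The difference quotient of \<open>f\<close>, with its removable singularity filled in.\<close>
  define H where "H = (\<lambda>a z. if z = a then deriv f a else (f z - f a) / (z - a))"
  define b where "b = (\<lambda>z. \<Prod>j=1..n. (z - a j) / (1 - cnj (a j) * z))"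
  \<comment> \<open>The quotient of \<open>P \<circ> f\<close> by \<open>b\<close>, in a form that is visibly holomorphic at the zeros of \<open>b\<close>.\<close>
  define q where "q = (\<lambda>z. lead_coeff P * (\<Prod>j=1..n. H (a j) z * (1 - cnj (a j) * z)))"
  have a1: "norm (a j) < 1" if "j \<in> {1..n}" for j using a[OF that] by simp
  have H: "H (a j) holomorphic_on ball 0 1" for j
    unfolding H_def by (rule pole_lemma_open[OF hol open_ball])
  have H0: "H (a j) z \<noteq> 0" if "j \<in> {1..n}" "z \<in> ball 0 1" for j z
    using holomorphic_injective_imp_regular[OF hol open_ball inj a[OF that(1)]]
      inj_onD[OF inj _ that(2) a[OF that(1)]] by (auto simp: H_def)
  have fact: "poly P (f z) = q z * b z" if z: "z \<in> ball 0 1" for z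
  proof -
    have "poly P (f z) = lead_coeff P * (\<Prod>j=1..n. f z - f (a j))"
      by (rule poly_eq_lead_prod[OF roots])
    also have "(\<Prod>j=1..n. f z - f (a j)) =
        (\<Prod>j=1..n. (H (a j) z * (1 - cnj (a j) * z)) * ((z - a j) / (1 - cnj (a j) * z)))"
    proof (rule prod.cong)
      fix j assume j: "j \<in> {1..n}"
      have "1 - cnj (a j) * z \<noteq> 0" using cnj_mult_neq_1[OF _ a1[OF j], of z] z by auto
      then show "f z - f (a j) = (H (a j) z * (1 - cnj (a j) * z)) * ((z - a j) / (1 - cnj (a j) * z))"
        by (simp add: H_def)
    qed simp
    finally show ?thesis by (simp only: q_def b_def prod.distrib mult.assoc)
  qed
  obtain c where c: "norm c = 1" "\<And>z. z \<in> ball 0 1 \<Longrightarrow> q z = c"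
  proof (rule constant_of_boundary_norm_1[of q])
    show "q holomorphic_on ball 0 1" unfolding q_def by (intro holomorphic_intros H)
    show "q z \<noteq> 0" if "z \<in> ball 0 1" for z
      using deg H0 that cnj_mult_neq_1[of z] a1 by (auto simp: q_def)
    show "((\<lambda>z. norm (q z)) \<longlongrightarrow> 1) (at \<zeta> within ball 0 1)" if \<zeta>: "\<zeta> \<in> sphere 0 1" for \<zeta>
    proof -
      have "(b \<longlongrightarrow> b \<zeta>) (at \<zeta> within ball 0 1)"
        unfolding b_def using norm_blaschke_factor(1)[of \<zeta>] \<zeta> a1 by (intro tendsto_intros) auto
      then have "((\<lambda>z. norm (b z)) \<longlongrightarrow> norm (b \<zeta>)) (at \<zeta> within ball 0 1)"
        by (rule tendsto_norm)
      moreover have "norm (b \<zeta>) = 1"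
        using norm_blaschke_product[of \<zeta> n a 0] \<zeta> a1 by (simp add: blaschke_product_def b_def)
      ultimately have b1: "((\<lambda>z. norm (b z)) \<longlongrightarrow> 1) (at \<zeta> within ball 0 1)" by simp
      have "((\<lambda>z. norm (poly P (f z)) / norm (b z)) \<longlongrightarrow> 1 / 1) (at \<zeta> within ball 0 1)"
        by (intro tendsto_divide interior_norm_tendsto_1[OF deg f \<zeta>] b1) simp
      moreover have "\<forall>\<^sub>F z in at \<zeta> within ball 0 1. z \<in> ball 0 1" by (auto simp: eventually_at_filter)
      then have "\<forall>\<^sub>F z in at \<zeta> within ball 0 1. norm (poly P (f z)) / norm (b z) = norm (q z)"
        using order_tendstoD(1)[OF b1 zero_less_one]
        by eventually_elim (auto simp: fact norm_mult)
      ultimately show ?thesis by (simp add: tendsto_cong)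
    qed
  qed blast
  have "c = cis (Arg c)" using c(1) rcis_cmod_Arg[of c] by (simp add: rcis_def)
  then have "poly P (f z) = blaschke_product n (Arg c) a z" if "z \<in> ball 0 1" for z
    using fact[OF that] c(2)[OF that] by (simp add: blaschke_product_def b_def)
  then show thesis by (rule that)
qed

section \<open>The exterior: a power\<close>

text \<open>
  The exterior mapping is studied in the coordinate \<open>w = 1 / z\<close>, as a function \<open>G\<close> on the
  punctured unit disc with a simple pole at \<open>0\<close>.
\<close>

lemma at_within_punctured_ball:
  assumes "\<zeta> \<in> sphere (0::complex) 1"
  shows "at \<zeta> within (ball 0 1 - {0}) = at \<zeta> within ball 0 1"
  using assms by (intro at_within_nhd[of _ "- {0}"]) auto

text \<open>
  Properness alone does not prevent \<open>G\<close> from being unbounded near the circle. But \<open>1 / G\<close> extends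
  holomorphically to \<open>0\<close>, so by the open mapping theorem \<open>G\<close> takes all values of large modulus in a
  small disc about the pole, and by injectivity it takes them nowhere else.
\<close>

lemma bounded_away_from_simple_pole:
  fixes G :: "complex \<Rightarrow> complex"
  assumes hol: "G holomorphic_on ball 0 1 - {0}" and inj: "inj_on G (ball 0 1 - {0})"
    and pole: "((\<lambda>w. w * G w) \<longlongrightarrow> a) (at 0)" "a \<noteq> 0"
  obtains \<delta> R where "0 < \<delta>" "\<delta> < 1" "\<And>w. \<lbrakk>w \<in> ball 0 1; \<delta> \<le> norm w\<rbrakk> \<Longrightarrow> norm (G w) \<le> R"
proof -
  have "\<forall>\<^sub>F w in at 0. w * G w \<noteq> 0"
    using tendsto_imp_eventually_ne[OF pole] .
  then obtain \<delta>0 where \<delta>0: "\<delta>0 > 0" "\<And>w. \<lbrakk>w \<noteq> 0; norm w < \<delta>0\<rbrakk> \<Longrightarrow> w * G w \<noteq> 0"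
    by (auto simp: eventually_at)
  define \<delta> where "\<delta> = min \<delta>0 (1 / 2)"
  have \<delta>: "0 < \<delta>" "\<delta> < 1" "\<And>w. \<lbrakk>w \<noteq> 0; norm w < \<delta>\<rbrakk> \<Longrightarrow> G w \<noteq> 0"
    using \<delta>0 by (auto simp: \<delta>_def)
  define p where "p = (\<lambda>w. if w = 0 then 0 else inverse (G w))"
  have "p holomorphic_on ball 0 \<delta>"
  proof (rule no_isolated_singularity'[where K = "{0}"])
    have "((\<lambda>w. w / (w * G w)) \<longlongrightarrow> 0 / a) (at 0)"
      by (intro tendsto_divide pole tendsto_ident_at)
    then have "(p \<longlongrightarrow> 0 / a) (at 0)"
      by (rule Lim_transform_eventually)
         (auto simp: p_def eventually_at_filter divide_simps)
    then show "(p \<longlongrightarrow> p z) (at z within ball 0 \<delta>)" if "z \<in> {0}" for z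
      using that by (auto simp: p_def intro: tendsto_within_subset)
    have "(\<lambda>w. inverse (G w)) holomorphic_on ball 0 \<delta> - {0}"
      using \<delta> by (intro holomorphic_intros holomorphic_on_subset[OF hol]) auto
    then show "p holomorphic_on ball 0 \<delta> - {0}"
      by (rule holomorphic_transform) (auto simp: p_def)
  qed auto
  moreover have "inj_on p (ball 0 \<delta>)"
  proof (rule inj_onI)
    fix x y assume xy: "x \<in> ball 0 \<delta>" "y \<in> ball 0 \<delta>" "p x = p y"
    show "x = y"
    proof (cases "x = 0 \<or> y = 0")
      case True
      then show ?thesis using xy \<delta>(3)[of x] \<delta>(3)[of y] by (auto simp: p_def split: if_splits)
    next
      case False
      then have "G x = G y" using xy by (simp add: p_def)
      then show ?thesis by (rule inj_onD[OF inj]) (use False xy \<delta>(2) in auto)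
    qed
  qed
  ultimately have "open (p ` ball 0 \<delta>)" by (intro open_mapping_thm3) auto
  moreover have "0 \<in> p ` ball 0 \<delta>" using \<delta>(1) by (intro image_eqI[of _ _ 0]) (auto simp: p_def)
  ultimately obtain e where e: "e > 0" "ball 0 e \<subseteq> p ` ball 0 \<delta>"
    by (meson open_contains_ball)
  have "norm (G w) \<le> 1 / e" if w: "w \<in> ball 0 1" "\<delta> \<le> norm w" for w
  proof (rule ccontr)
    assume "\<not> norm (G w) \<le> 1 / e"
    then have gt: "norm (G w) > 1 / e" by simp
    then have G0: "norm (G w) > 0" using e(1) by (meson less_trans zero_less_divide_1_iff)
    have "norm (inverse (G w)) < e"
      using gt G0 e(1) by (simp add: norm_inverse norm_divide divide_simps mult.commute)
    then have "inverse (G w) \<in> p ` ball 0 \<delta>" using e(2) by auto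
    then obtain v where v: "v \<in> ball 0 \<delta>" "inverse (G w) = p v" by auto
    then have "v \<noteq> 0" using G0 by (auto simp: p_def)
    then have "G w = G v" using v by (simp add: p_def)
    then have "w = v" by (rule inj_onD[OF inj]) (use v w \<delta> \<open>v \<noteq> 0\<close> in auto)
    then show False using v w by auto
  qed
  then show thesis using that \<delta>(1,2) by blast
qed

lemma exterior_norm_tendsto_1:
  assumes deg: "degree P > 0"
    and hol: "G holomorphic_on ball 0 1 - {0}" and inj: "inj_on G (ball 0 1 - {0})"
    and im: "G ` (ball 0 1 - {0}) = {z. norm (poly P z) > 1}"
    and pole: "((\<lambda>w. w * G w) \<longlongrightarrow> a) (at 0)" "a \<noteq> 0"
    and \<zeta>: "\<zeta> \<in> sphere 0 1"
  shows "((\<lambda>z. norm (poly P (G z))) \<longlongrightarrow> 1) (at \<zeta> within ball 0 1)"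
proof -
  obtain \<delta> R where \<delta>: "0 < \<delta>" "\<delta> < 1" "\<And>w. \<lbrakk>w \<in> ball 0 1; \<delta> \<le> norm w\<rbrakk> \<Longrightarrow> norm (G w) \<le> R"
    using bounded_away_from_simple_pole[OF hol inj pole] by metis
  have in_S: "\<forall>\<^sub>F z in at \<zeta> within (ball 0 1 - {0}). z \<in> ball 0 1 - {0}"
    by (auto simp: eventually_at_filter)
  have "((\<lambda>z. norm (poly P (G z))) \<longlongrightarrow> 1) (at \<zeta> within (ball 0 1 - {0}))"
  proof (rule order_tendstoI)
    fix l :: real assume "l < 1"
    show "\<forall>\<^sub>F z in at \<zeta> within (ball 0 1 - {0}). l < norm (poly P (G z))"
      using in_S
    proof eventually_elim
      case (elim z)
      then have "G z \<in> {z. norm (poly P z) > 1}" using im by blast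
      then show ?case using \<open>l < 1\<close> by simp
    qed
  next
    fix u :: real assume "1 < u"
    define K where "K = cball 0 R \<inter> {z. u \<le> norm (poly P z)}"
    have "compact K" unfolding K_def
      by (intro compact_Int_closed compact_cball closed_Collect_le continuous_intros)
    moreover have "K \<subseteq> G ` (ball 0 1 - {0})" unfolding im K_def using \<open>1 < u\<close> by auto
    ultimately have "\<forall>\<^sub>F z in at \<zeta> within (ball 0 1 - {0}). G z \<notin> K"
      using \<zeta> by (intro eventually_avoids_compact[OF hol _ inj]) (auto intro: open_Diff)
    moreover have "\<forall>\<^sub>F z in at \<zeta> within (ball 0 1 - {0}). \<delta> < norm z"
      using \<zeta> \<delta>(2) by (intro order_tendstoD(1)[where y = "norm \<zeta>"] tendsto_intros) auto
    ultimately show "\<forall>\<^sub>F z in at \<zeta> within (ball 0 1 - {0}). norm (poly P (G z)) < u"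
      using in_S
    proof eventually_elim
      case (elim z)
      then have "norm (G z) \<le> R" using \<delta>(3)[of z] by auto
      then show ?case using elim by (auto simp: K_def)
    qed
  qed
  then show ?thesis by (simp add: at_within_punctured_ball[OF \<zeta>])
qed

text \<open>
  \<open>P \<circ> G\<close> has a pole of order exactly \<open>degree P\<close> at \<open>0\<close> and no zeros, because \<open>norm P > 1\<close> on the
  image of \<open>G\<close>. Multiplying by the power of \<open>w\<close> removes the pole and leaves a function without
  zeros and with boundary modulus \<open>1\<close>.
\<close>

lemma poly_comp_exterior_eq_power:
  assumes deg: "degree P > 0"
    and hol: "G holomorphic_on ball 0 1 - {0}" and inj: "inj_on G (ball 0 1 - {0})"
    and im: "G ` (ball 0 1 - {0}) = {z. norm (poly P z) > 1}"
    and pole: "((\<lambda>w. w * G w) \<longlongrightarrow> a) (at 0)" "a \<noteq> 0"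
  obtains c where "norm c = 1" "\<And>w. w \<in> ball 0 1 - {0} \<Longrightarrow> w ^ degree P * poly P (G w) = c"
proof -
  let ?n = "degree P"
  define g where "g = (\<lambda>w. if w = 0 then lead_coeff P * a ^ ?n else w ^ ?n * poly P (G w))"
  have lim0: "(g \<longlongrightarrow> lead_coeff P * a ^ ?n) (at 0)"
  proof -
    \<comment> \<open>Each monomial is rewritten through \<open>w * G w\<close>, which has a limit; only the leading one survives.\<close>
    have "((\<lambda>w. \<Sum>i\<le>?n. coeff P i * (w * G w) ^ i * w ^ (?n - i)) \<longlongrightarrow>
        (\<Sum>i\<le>?n. coeff P i * a ^ i * 0 ^ (?n - i))) (at 0)"
      by (intro tendsto_intros pole)
    moreover have "(\<Sum>i\<le>?n. coeff P i * a ^ i * 0 ^ (?n - i)) = lead_coeff P * a ^ ?n"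
      by (subst sum.remove[of _ ?n]) (auto intro!: sum.neutral)
    moreover have "(\<Sum>i\<le>?n. coeff P i * (w * G w) ^ i * w ^ (?n - i)) = w ^ ?n * poly P (G w)" for w
      unfolding poly_altdef sum_distrib_left
    proof (rule sum.cong)
      fix i assume "i \<in> {..?n}"
      then have "w ^ ?n = w ^ i * w ^ (?n - i)" by (simp flip: power_add)
      then show "coeff P i * (w * G w) ^ i * w ^ (?n - i) = w ^ ?n * (coeff P i * G w ^ i)"
        by (simp add: power_mult_distrib)
    qed simp
    ultimately have "((\<lambda>w. w ^ ?n * poly P (G w)) \<longlongrightarrow> lead_coeff P * a ^ ?n) (at 0)" by simp
    then show ?thesis
      by (rule Lim_transform_eventually) (auto simp: g_def eventually_at_filter)
  qed
  obtain c where c: "norm c = 1" "\<And>z. z \<in> ball 0 1 \<Longrightarrow> g z = c"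
  proof (rule constant_of_boundary_norm_1[of g])
    show "g holomorphic_on ball 0 1"
    proof (rule no_isolated_singularity'[where K = "{0}"])
      show "(g \<longlongrightarrow> g z) (at z within ball 0 1)" if "z \<in> {0}" for z
        using that lim0 by (auto simp: g_def intro: tendsto_within_subset)
      have "(\<lambda>w. w ^ ?n * poly P (G w)) holomorphic_on ball 0 1 - {0}"
        by (intro holomorphic_intros hol)
      then show "g holomorphic_on ball 0 1 - {0}"
        by (rule holomorphic_transform) (auto simp: g_def)
    qed auto
    show "g z \<noteq> 0" if z: "z \<in> ball 0 1" for z
    proof (cases "z = 0")
      case True then show ?thesis using deg pole(2) by (auto simp: g_def)
    next
      case False
      then have "G z \<in> {z. norm (poly P z) > 1}" using im z by blast
      then show ?thesis using False by (auto simp: g_def)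
    qed
    show "((\<lambda>z. norm (g z)) \<longlongrightarrow> 1) (at \<zeta> within ball 0 1)" if \<zeta>: "\<zeta> \<in> sphere 0 1" for \<zeta>
    proof -
      have "((\<lambda>z. norm z ^ ?n * norm (poly P (G z))) \<longlongrightarrow> norm \<zeta> ^ ?n * 1) (at \<zeta> within ball 0 1)"
        by (intro tendsto_intros exterior_norm_tendsto_1[OF deg hol inj im pole \<zeta>])
      then have "((\<lambda>z. norm z ^ ?n * norm (poly P (G z))) \<longlongrightarrow> 1) (at \<zeta> within (ball 0 1 - {0}))"
        using \<zeta> by (simp add: at_within_punctured_ball)
      then have "((\<lambda>z. norm (g z)) \<longlongrightarrow> 1) (at \<zeta> within (ball 0 1 - {0}))"
        by (rule Lim_transform_eventually)
           (auto simp: g_def eventually_at_filter norm_mult norm_power)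
      then show ?thesis using \<zeta> by (simp add: at_within_punctured_ball)
    qed
  qed blast
  have "w ^ ?n * poly P (G w) = c" if "w \<in> ball 0 1 - {0}" for w
    using c(2)[of w] that by (simp add: g_def)
  then show thesis using c(1) that by blast
qed

lemma inverse_mem_exterior:
  "w \<in> ball 0 1 - {0} \<Longrightarrow> inverse w \<in> - cball (0::complex) 1"
  by (auto simp: norm_inverse not_le one_less_inverse)

lemma inverse_mem_punctured_ball:
  "z \<in> - cball 0 1 \<Longrightarrow> inverse z \<in> ball (0::complex) 1 - {0}"
  by (auto simp: norm_inverse inverse_less_1_iff)

lemma inverse_image_punctured_ball: "inverse ` (ball 0 1 - {0}) = - cball (0::complex) 1"
proof (intro equalityI subsetI)
  fix z :: complex assume "z \<in> - cball 0 1"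
  then show "z \<in> inverse ` (ball 0 1 - {0})"
    by (intro image_eqI[of _ _ "inverse z"] inverse_mem_punctured_ball) auto
qed (use inverse_mem_exterior in blast)

text \<open>
  The expansion at infinity is a power series in \<open>w\<close>, so \<open>F (1 / w) - a / w\<close> has a limit at \<open>0\<close>,
  which makes the pole simple with residue \<open>a\<close>.
\<close>

lemma exterior_mapping_inverted:
  assumes "exterior_mapping \<Omega> F"
  obtains a where "a \<noteq> 0" "((\<lambda>w. w * F (inverse w)) \<longlongrightarrow> a) (at 0)"
    "(\<lambda>w. F (inverse w)) holomorphic_on ball 0 1 - {0}"
    "inj_on (\<lambda>w. F (inverse w)) (ball 0 1 - {0})"
    "(\<lambda>w. F (inverse w)) ` (ball 0 1 - {0}) = - closure \<Omega>"
proof -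
  have hol: "F holomorphic_on - cball 0 1" and inj: "inj_on F (- cball 0 1)"
    and im: "F ` (- cball 0 1) = - closure \<Omega>"
    using assms by (auto simp: exterior_mapping_def bij_betw_def)
  obtain a :: real and c where a: "a > 0"
    and ev: "\<forall>\<^sub>F z in at_infinity. (\<lambda>m. c m / z ^ m) sums (F z - of_real a * z)"
    using assms by (auto simp: exterior_mapping_def)
  obtain b where b: "\<And>z. norm z \<ge> b \<Longrightarrow> (\<lambda>m. c m / z ^ m) sums (F z - of_real a * z)"
    using ev by (auto simp: eventually_at_infinity)
  define B where "B = max b 1"
  have "((\<lambda>w. F (inverse w) - of_real a * inverse w) \<longlongrightarrow> c 0) (at 0)"
  proof (rule powser_limit_0_strong[where s = "inverse B"])
    show "0 < inverse B" by (simp add: B_def)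
    fix w :: complex assume w: "w \<noteq> 0" "norm w < inverse B"
    then have "B < norm (inverse w)"
      using less_imp_inverse_less[of "norm w" "inverse B"] by (simp add: norm_inverse)
    then have "(\<lambda>m. c m / inverse w ^ m) sums (F (inverse w) - of_real a * inverse w)"
      by (intro b) (simp add: B_def)
    then show "(\<lambda>m. c m * w ^ m) sums (F (inverse w) - of_real a * inverse w)"
      by (simp add: field_simps)
  qed
  then have "((\<lambda>w. w * (F (inverse w) - of_real a * inverse w) + of_real a) \<longlongrightarrow> 0 * c 0 + of_real a) (at 0)"
    by (intro tendsto_intros)
  then have lim: "((\<lambda>w. w * F (inverse w)) \<longlongrightarrow> 0 * c 0 + of_real a) (at 0)"
    by (rule Lim_transform_eventually) (auto simp: eventually_at_filter field_simps)
  note inv = inverse_image_punctured_ball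
  show thesis
  proof (rule that[of "of_real a"])
    show "(\<lambda>w. F (inverse w)) holomorphic_on ball 0 1 - {0}"
    proof -
      have "inverse holomorphic_on ball 0 1 - {0 :: complex}"
        using holomorphic_on_inverse[OF holomorphic_on_ident, of "ball 0 1 - {0}"] by simp
      from holomorphic_on_compose_gen[OF this hol] show ?thesis
        using inv by (simp add: comp_def)
    qed
    show "inj_on (\<lambda>w. F (inverse w)) (ball 0 1 - {0})"
    proof -
      have "inj_on inverse (ball 0 1 - {0 :: complex})" by (simp add: inj_on_def)
      from comp_inj_on[OF this, of F] inj show ?thesis by (simp add: inv comp_def)
    qed
    show "(\<lambda>w. F (inverse w)) ` (ball 0 1 - {0}) = - closure \<Omega>"
      by (simp only: image_image[of F inverse, symmetric] inv im)
  qed (use a lim in auto)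
qed

section \<open>Boundary values of the two mappings\<close>

text \<open>
  The Blaschke product is continuous across the circle, so \<open>P \<circ> f\<close> has boundary limits, and
  with it \<open>f\<close>.
\<close>

lemma interior_boundary_values:
  assumes deg: "degree P > 0" and hol: "f holomorphic_on ball 0 1"
    and eq: "\<And>z. z \<in> ball 0 1 \<Longrightarrow> poly P (f z) = blaschke_product n \<theta> a z"
    and a: "\<And>j. j \<in> {1..n} \<Longrightarrow> a j \<in> ball 0 1" and \<zeta>: "\<zeta> \<in> sphere 0 1"
  shows "(f \<longlongrightarrow> boundary_values (ball 0 1) f \<zeta>) (at \<zeta> within ball 0 1)"
    and "poly P (boundary_values (ball 0 1) f \<zeta>) = blaschke_product n \<theta> a \<zeta>"
proof -
  have "(blaschke_product n \<theta> a \<longlongrightarrow> blaschke_product n \<theta> a \<zeta>) (at \<zeta> within ball 0 1)"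
    unfolding blaschke_product_def using norm_blaschke_factor(1)[of \<zeta>] \<zeta> a
    by (intro tendsto_intros) auto
  then have lim: "((\<lambda>z. poly P (f z)) \<longlongrightarrow> blaschke_product n \<theta> a \<zeta>) (at \<zeta> within ball 0 1)"
    by (rule Lim_transform_eventually) (auto simp: eventually_at_filter eq)
  obtain w where w: "poly P w = blaschke_product n \<theta> a \<zeta>" "(f \<longlongrightarrow> w) (at \<zeta> within ball 0 1)"
  proof (rule limit_of_poly_limit[OF deg holomorphic_on_imp_continuous_on[OF hol]
        islimpt_unit_ball[OF \<zeta>] _ zero_less_one _ lim])
    show "connected (ball 0 1 \<inter> ball \<zeta> r)" for r
      by (intro convex_connected convex_Int convex_ball)
  qed (use \<zeta> in auto)
  have "boundary_values (ball 0 1) f \<zeta> = w"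
    unfolding boundary_values_def using islimpt_unit_ball[OF \<zeta>] w(2)
    by (intro tendsto_Lim) (auto simp: trivial_limit_within)
  then show "(f \<longlongrightarrow> boundary_values (ball 0 1) f \<zeta>) (at \<zeta> within ball 0 1)"
    "poly P (boundary_values (ball 0 1) f \<zeta>) = blaschke_product n \<theta> a \<zeta>"
    using w by auto
qed

lemma filterlim_radial:
  fixes z :: complex
  assumes "z \<in> sphere 0 1"
  shows "filterlim (\<lambda>t. of_real t * z) (at z within (- cball 0 1)) (at_right 1)"
  unfolding filterlim_at
proof
  have "\<forall>\<^sub>F t :: real in at_right 1. t > 1" by (auto simp: eventually_at_filter)
  then show "\<forall>\<^sub>F t in at_right 1. of_real t * z \<in> - cball 0 1 \<and> of_real t * z \<noteq> z"
    by eventually_elim (use assms in \<open>auto simp: norm_mult\<close>)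
  have "((\<lambda>t. of_real t * z) \<longlongrightarrow> of_real 1 * z) (at_right 1)"
    by (intro tendsto_intros)
  then show "((\<lambda>t. of_real t * z) \<longlongrightarrow> z) (at_right 1)" by simp
qed

lemma islimpt_exterior: "z \<in> sphere 0 1 \<Longrightarrow> z islimpt - cball (0::complex) 1"
  by (metis filterlim_radial filterlim_def le_bot filtermap_bot_iff trivial_limit_at_right_real
      trivial_limit_within)

text \<open>
  Small discs about points of the circle meet the unit disc, but not its exterior, in a convex set;
  hence the passage to \<open>w = 1 / z\<close> before the connectedness argument.
\<close>

lemma exterior_boundary_values:
  assumes deg: "degree P > 0" and hol: "F holomorphic_on - cball 0 1"
    and eq: "\<And>z. z \<in> - cball 0 1 \<Longrightarrow> poly P (F z) = c * z ^ n" and \<zeta>: "\<zeta> \<in> sphere 0 1"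
  shows "(F \<longlongrightarrow> boundary_values (- cball 0 1) F \<zeta>) (at \<zeta> within (- cball 0 1))"
    and "poly P (boundary_values (- cball 0 1) F \<zeta>) = c * \<zeta> ^ n"
proof -
  define G where "G = (\<lambda>w. F (inverse w))"
  note inv = inverse_mem_exterior
  have contG: "continuous_on (ball 0 1 - {0}) G"
    unfolding G_def using inv
    by (intro continuous_on_compose2[OF holomorphic_on_imp_continuous_on[OF hol]] continuous_intros) auto
  have \<zeta>': "inverse \<zeta> \<in> sphere 0 1" "\<zeta> \<noteq> 0" using \<zeta> by (auto simp: norm_inverse)
  have "((\<lambda>w. c * inverse w ^ n) \<longlongrightarrow> c * inverse (inverse \<zeta>) ^ n) (at (inverse \<zeta>) within (ball 0 1 - {0}))"
    using \<zeta>' by (intro tendsto_intros) auto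
  then have "((\<lambda>w. c * inverse w ^ n) \<longlongrightarrow> c * \<zeta> ^ n) (at (inverse \<zeta>) within (ball 0 1 - {0}))" by simp
  then have lim: "((\<lambda>w. poly P (G w)) \<longlongrightarrow> c * \<zeta> ^ n) (at (inverse \<zeta>) within (ball 0 1 - {0}))"
    by (rule Lim_transform_eventually) (use inv in \<open>auto simp: eventually_at_filter eq G_def\<close>)
  obtain w where w: "poly P w = c * \<zeta> ^ n" "(G \<longlongrightarrow> w) (at (inverse \<zeta>) within (ball 0 1 - {0}))"
  proof (rule limit_of_poly_limit[OF deg contG _ _ zero_less_one _ lim])
    show "inverse \<zeta> islimpt ball 0 1 - {0}"
      using islimpt_unit_ball[OF \<zeta>'(1)] at_within_punctured_ball[OF \<zeta>'(1)]
      by (metis trivial_limit_within)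
    fix r :: real assume "r \<le> 1"
    then have "(ball 0 1 - {0}) \<inter> ball (inverse \<zeta>) r = ball 0 1 \<inter> ball (inverse \<zeta>) r"
      using \<zeta>' by auto
    then show "connected ((ball 0 1 - {0}) \<inter> ball (inverse \<zeta>) r)"
      by (simp add: convex_connected convex_Int)
  qed (use \<zeta>' in auto)
  have "filterlim inverse (at (inverse \<zeta>) within (ball 0 1 - {0})) (at \<zeta> within (- cball 0 1))"
    unfolding filterlim_at
  proof
    show "(inverse \<longlongrightarrow> inverse \<zeta>) (at \<zeta> within - cball 0 1)"
      using \<zeta>' by (intro tendsto_intros)
    show "\<forall>\<^sub>F z in at \<zeta> within - cball 0 1. inverse z \<in> ball 0 1 - {0} \<and> inverse z \<noteq> inverse \<zeta>"
      unfolding eventually_at_filter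
      by (intro always_eventually allI impI conjI inverse_mem_punctured_ball) auto
  qed
  from filterlim_compose[OF w(2) this]
  have F: "(F \<longlongrightarrow> w) (at \<zeta> within (- cball 0 1))" by (simp add: G_def)
  have "boundary_values (- cball 0 1) F \<zeta> = w"
    unfolding boundary_values_def using islimpt_exterior[OF \<zeta>] F
    by (intro tendsto_Lim) (auto simp: trivial_limit_within)
  then show "(F \<longlongrightarrow> boundary_values (- cball 0 1) F \<zeta>) (at \<zeta> within (- cball 0 1))"
    "poly P (boundary_values (- cball 0 1) F \<zeta>) = c * \<zeta> ^ n"
    using w F by auto
qed

text \<open>
  Smoothness of the curve enters here. If \<open>\<psi> x = \<psi> y\<close>, then \<open>x ^ n = y ^ n\<close>, so along the rays
  through \<open>x\<close> and \<open>y\<close> the polynomial \<open>P\<close> takes equal values at \<open>F (t x)\<close> and \<open>F (t y)\<close>. Both points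
  tend to \<open>\<psi> x\<close> as \<open>t\<close> decreases to \<open>1\<close>, and \<open>P\<close> is injective near \<open>\<psi> x\<close>; hence they coincide.
\<close>

lemma exterior_boundary_inj:
  fixes P :: "complex poly" and F \<psi> :: "complex \<Rightarrow> complex"
  assumes inj: "inj_on F (- cball 0 1)"
    and eq: "\<And>z. z \<in> - cball 0 1 \<Longrightarrow> poly P (F z) = c * z ^ n"
    and smooth: "\<And>w. norm (poly P w) = 1 \<Longrightarrow> poly (pderiv P) w \<noteq> 0"
    and c: "norm c = 1"
    and lim: "\<And>\<zeta>. \<zeta> \<in> sphere 0 1 \<Longrightarrow> (F \<longlongrightarrow> \<psi> \<zeta>) (at \<zeta> within (- cball 0 1))"
    and P\<psi>: "\<And>\<zeta>. \<zeta> \<in> sphere 0 1 \<Longrightarrow> poly P (\<psi> \<zeta>) = c * \<zeta> ^ n"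
  shows "inj_on \<psi> (sphere 0 1)"
proof (rule inj_onI)
  fix x y assume x: "x \<in> sphere 0 1" and y: "y \<in> sphere 0 1" and xy: "\<psi> x = \<psi> y"
  have "c * x ^ n = c * y ^ n" using P\<psi>[OF x] P\<psi>[OF y] xy by metis
  then have pow: "x ^ n = y ^ n" using c by auto
  have "norm (poly P (\<psi> x)) = 1" using P\<psi>[OF x] c x by (simp add: norm_mult norm_power)
  then have "deriv (poly P) (\<psi> x) \<noteq> 0"
    using smooth DERIV_imp_deriv[OF poly_DERIV[of P]] by simp
  moreover have "poly P holomorphic_on UNIV" by (intro holomorphic_intros)
  ultimately obtain r where r: "r > 0" "inj_on (poly P) (ball (\<psi> x) r)"
    using has_complex_derivative_locally_injective[of "poly P" UNIV "\<psi> x"] by auto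
  have near: "\<forall>\<^sub>F t in at_right 1. F (of_real t * z) \<in> ball (\<psi> x) r"
    if z: "z \<in> sphere 0 1" "\<psi> z = \<psi> x" for z
    using topological_tendstoD[OF filterlim_compose[OF lim[OF z(1)] filterlim_radial[OF z(1)]], of "ball (\<psi> x) r"]
      z(2) r(1) by simp
  have "\<forall>\<^sub>F t :: real in at_right 1. t > 1" by (auto simp: eventually_at_filter)
  then have "\<forall>\<^sub>F t :: real in at_right 1. x = y"
    using near[OF x refl] near[OF y xy[symmetric]]
  proof eventually_elim
    case (elim t)
    have out: "of_real t * x \<in> - cball 0 1" "of_real t * y \<in> - cball 0 1"
      using elim(1) x y by (auto simp: norm_mult)
    have "poly P (F (of_real t * x)) = poly P (F (of_real t * y))"
      using eq[OF out(1)] eq[OF out(2)] pow by (simp add: power_mult_distrib)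
    then have "F (of_real t * x) = F (of_real t * y)"
      using inj_onD[OF r(2)] elim by blast
    then have "of_real t * x = of_real t * y" using inj_onD[OF inj _ out] by blast
    then show "x = y" using elim(1) by simp
  qed
  then show "x = y" by simp
qed

text \<open>
  A point of the curve is a limit of values \<open>F (z m)\<close>. Since \<open>norm (z m) ^ n\<close> tends to \<open>1\<close>, the
  points \<open>z m\<close> accumulate on the circle, and the boundary value there is the given point.
\<close>

lemma exterior_boundary_surj:
  fixes P :: "complex poly" and F \<psi> :: "complex \<Rightarrow> complex"
  assumes deg: "degree P > 0" and n: "n > 0"
    and im: "F ` (- cball 0 1) = {w. norm (poly P w) > 1}"
    and eq: "\<And>z. z \<in> - cball 0 1 \<Longrightarrow> poly P (F z) = c * z ^ n"
    and c: "norm c = 1"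
    and lim: "\<And>\<zeta>. \<zeta> \<in> sphere 0 1 \<Longrightarrow> (F \<longlongrightarrow> \<psi> \<zeta>) (at \<zeta> within (- cball 0 1))"
    and w: "norm (poly P w) = 1"
  shows "w \<in> \<psi> ` sphere 0 1"
proof -
  obtain x where x: "\<And>m. norm (poly P (x m)) > 1" "x \<longlonglongrightarrow> w"
    using lemniscate_subset_closure(2)[OF deg w] by (auto simp: closure_sequential)
  have "\<exists>z. z \<in> - cball 0 1 \<and> F z = x m" for m
  proof -
    have "x m \<in> F ` (- cball 0 1)" unfolding im using x(1) by simp
    then show ?thesis by auto
  qed
  then obtain z where z: "\<And>m. z m \<in> - cball 0 1" "\<And>m. F (z m) = x m" by metis
  have norm_z: "norm (poly P (x m)) = norm (z m) ^ n" for m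
    using eq[OF z(1), of m] c by (simp add: z(2) norm_mult norm_power)
  have "(\<lambda>m. norm (poly P (x m))) \<longlonglongrightarrow> norm (poly P w)" by (intro tendsto_intros x)
  then have pow1: "(\<lambda>m. norm (z m) ^ n) \<longlonglongrightarrow> 1" by (simp add: norm_z w)
  then obtain M where M: "\<And>m. norm (z m) ^ n \<le> M"
    using convergent_imp_Bseq[OF convergentI[OF pow1]] by (auto simp: Bseq_def)
  have "norm (z m) \<le> M" for m
    using self_le_power[of "norm (z m)" n] z(1)[of m] M[of m] n by auto
  then have "bounded (range z)" by (auto simp: bounded_iff)
  then obtain l r where r: "strict_mono r" "(z \<circ> r) \<longlonglongrightarrow> l"
    using bounded_imp_convergent_subsequence by metis
  have "(\<lambda>m. norm ((z \<circ> r) m) ^ n) \<longlonglongrightarrow> norm l ^ n" by (intro tendsto_intros r)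
  moreover have "(\<lambda>m. norm ((z \<circ> r) m) ^ n) \<longlonglongrightarrow> 1"
    using LIMSEQ_subseq_LIMSEQ[OF pow1 r(1)] by (simp add: comp_def)
  ultimately have "norm l ^ n = 1" by (rule LIMSEQ_unique)
  then have l: "l \<in> sphere 0 1" using n power_eq_imp_eq_base[of "norm l" n 1] by simp
  have "(z \<circ> r) m \<in> - cball 0 1 \<and> (z \<circ> r) m \<noteq> l" for m
    using z(1)[of "r m"] l by auto
  then have "filterlim (z \<circ> r) (at l within (- cball 0 1)) sequentially"
    unfolding filterlim_at using r(2) by (auto intro!: always_eventually simp del: comp_apply)
  then have "(\<lambda>m. F ((z \<circ> r) m)) \<longlonglongrightarrow> \<psi> l"
    using filterlim_compose[OF lim[OF l]] by blast
  moreover have "(\<lambda>m. F ((z \<circ> r) m)) \<longlonglongrightarrow> w"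
    using LIMSEQ_subseq_LIMSEQ[OF x(2) r(1)] by (simp add: z(2) comp_def)
  ultimately have "\<psi> l = w" by (rule LIMSEQ_unique)
  then show ?thesis using l by blast
qed

lemma poly_comp_exterior_mapping:
  assumes deg: "degree P > 0" and F: "exterior_mapping (inside (lemniscate P)) F"
  obtains c where "norm c = 1" "\<And>z. z \<in> - cball 0 1 \<Longrightarrow> poly P (F z) = c * z ^ degree P"
proof -
  have cl: "- closure (inside (lemniscate P)) = {w. norm (poly P w) > 1}"
    using closure_lemniscate_interior[OF deg] by (auto simp: inside_lemniscate[OF deg])
  obtain a where a: "a \<noteq> 0" "((\<lambda>w. w * F (inverse w)) \<longlongrightarrow> a) (at 0)"
    "(\<lambda>w. F (inverse w)) holomorphic_on ball 0 1 - {0}"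
    "inj_on (\<lambda>w. F (inverse w)) (ball 0 1 - {0})"
    "(\<lambda>w. F (inverse w)) ` (ball 0 1 - {0}) = {w. norm (poly P w) > 1}"
    using exterior_mapping_inverted[OF F] cl by metis
  obtain c where c: "norm c = 1"
    "\<And>w. w \<in> ball 0 1 - {0} \<Longrightarrow> w ^ degree P * poly P (F (inverse w)) = c"
    using poly_comp_exterior_eq_power[OF deg a(3-5) a(2,1)] by metis
  have "poly P (F z) = c * z ^ degree P" if z: "z \<in> - cball 0 1" for z
  proof -
    have "inverse z \<in> ball 0 1 - {0}" "z \<noteq> 0"
      using inverse_mem_punctured_ball[OF z] z by auto
    then show ?thesis using c(2)[of "inverse z"] by (simp add: field_simps)
  qed
  then show thesis using that c(1) by blast
qed

section \<open>The fingerprint of a lemniscate\<close>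

theorem theorem2p2:
  fixes n :: nat and P :: "complex poly"
    and \<Phi>m k :: "complex \<Rightarrow> complex" and \<xi> a :: "nat \<Rightarrow> complex"
  assumes "n \<ge> 1"
    and "proper_lemniscate n P"
    and "riemann_mapping (lemniscate_interior P) \<Phi>m"
    and "is_fingerprint (lemniscate P) \<Phi>m k"
    and "image_mset \<xi> (mset_set {1..n}) = proots P"
    and "\<And>j. j \<in> {1..n} \<Longrightarrow> a j = inv_into (ball 0 1) \<Phi>m (\<xi> j)"
  shows "(\<forall>j \<in> {1..n}. a j \<in> ball 0 1) \<and>
         (\<exists>\<theta>::real. is_circle_root n (blaschke_product n \<theta> a) k)"
proof -
  have degn: "degree P = n" and smooth: "\<And>w. norm (poly P w) = 1 \<Longrightarrow> poly (pderiv P) w \<noteq> 0"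
    using assms(2) by (auto simp: proper_lemniscate_def lemniscate_def)
  have deg: "degree P > 0" using degn assms(1) by simp
  have hol: "\<Phi>m holomorphic_on ball 0 1" and im: "\<Phi>m ` ball 0 1 = lemniscate_interior P"
    using assms(3) by (auto simp: riemann_mapping_def bij_betw_def)
  have \<xi>: "\<xi> j \<in> \<Phi>m ` ball 0 1" if j: "j \<in> {1..n}" for j
  proof -
    have "poly P (\<xi> j) = lead_coeff P * (\<Prod>i\<in>{1..n}. \<xi> j - \<xi> i)"
      by (rule poly_eq_lead_prod[OF assms(5)])
    also have "\<dots> = 0" using j by auto
    finally show ?thesis by (simp add: im lemniscate_interior_def)
  qed
  have a: "a j \<in> ball 0 1" if "j \<in> {1..n}" for j
    using inv_into_into[OF \<xi>[OF that]] assms(6)[OF that] by simp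
  have \<Phi>a: "\<Phi>m (a j) = \<xi> j" if "j \<in> {1..n}" for j
    using f_inv_into_f[OF \<xi>[OF that]] assms(6)[OF that] by simp
  have "image_mset (\<lambda>j. \<Phi>m (a j)) (mset_set {1..n}) = image_mset \<xi> (mset_set {1..n})"
    by (rule image_mset_cong) (simp add: \<Phi>a)
  then have roots: "image_mset (\<lambda>j. \<Phi>m (a j)) (mset_set {1..n}) = proots P"
    using assms(5) by simp
  obtain \<theta> where \<theta>: "\<And>z. z \<in> ball 0 1 \<Longrightarrow> poly P (\<Phi>m z) = blaschke_product n \<theta> a z"
    using poly_comp_interior_eq_blaschke[OF deg assms(3) roots a] by blast
  define \<phi> where "\<phi> = boundary_values (ball 0 1) \<Phi>m"
  have \<phi>: "(\<Phi>m \<longlongrightarrow> \<phi> z) (at z within ball 0 1)" "poly P (\<phi> z) = blaschke_product n \<theta> a z"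
    if "z \<in> sphere 0 1" for z
    unfolding \<phi>_def using interior_boundary_values[OF deg hol \<theta> a that] by blast+
  obtain F where F: "exterior_mapping (inside (lemniscate P)) F"
    and k: "\<And>z. z \<in> sphere 0 1 \<Longrightarrow>
      k z = inv_into (sphere 0 1) (boundary_values (- cball 0 1) F) (boundary_values (ball 0 1) \<Phi>m z)"
    using assms(4) by (auto simp: is_fingerprint_def)
  define \<psi> where "\<psi> = boundary_values (- cball 0 1) F"
  have holF: "F holomorphic_on - cball 0 1" and injF: "inj_on F (- cball 0 1)"
    and imF: "F ` (- cball 0 1) = {w. norm (poly P w) > 1}"
    using F closure_lemniscate_interior[OF deg]
    by (auto simp: exterior_mapping_def bij_betw_def inside_lemniscate[OF deg])
  obtain c where c: "norm c = 1" "\<And>z. z \<in> - cball 0 1 \<Longrightarrow> poly P (F z) = c * z ^ n"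
    using poly_comp_exterior_mapping[OF deg F] degn by metis
  have \<psi>: "(F \<longlongrightarrow> \<psi> z) (at z within (- cball 0 1))" "poly P (\<psi> z) = c * z ^ n"
    if "z \<in> sphere 0 1" for z
    unfolding \<psi>_def using exterior_boundary_values[OF deg holF c(2) that] by blast+
  have cont\<phi>: "continuous_on (sphere 0 1) \<phi>" and cont\<psi>: "continuous_on (sphere 0 1) \<psi>"
    using continuous_on_boundary_limits[OF \<phi>(1) islimpt_unit_ball]
      continuous_on_boundary_limits[OF \<psi>(1) islimpt_exterior] by blast+
  have inj\<psi>: "inj_on \<psi> (sphere 0 1)"
    by (rule exterior_boundary_inj[OF injF c(2) smooth c(1) \<psi>])
  have \<phi>_unit: "norm (poly P (\<phi> z)) = 1" if z: "z \<in> sphere 0 1" for z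
    using \<phi>(2)[OF z] norm_blaschke_product[of z n a \<theta>] z a by simp
  have \<phi>_range: "\<phi> z \<in> \<psi> ` sphere 0 1" if z: "z \<in> sphere 0 1" for z
    using exterior_boundary_surj[OF deg _ imF c(2,1) \<psi>(1) \<phi>_unit[OF z]] assms(1) by simp
  have k_in: "k z \<in> sphere 0 1" and \<psi>k: "\<psi> (k z) = \<phi> z" if z: "z \<in> sphere 0 1" for z
    using inv_into_into[OF \<phi>_range[OF z]] f_inv_into_f[OF \<phi>_range[OF z]] k[OF z]
    by (simp_all add: \<phi>_def \<psi>_def)
  have "continuous_on (\<psi> ` sphere 0 1) (inv_into (sphere 0 1) \<psi>)"
    by (rule continuous_on_inv[OF cont\<psi> compact_sphere]) (simp add: inj\<psi>)
  then have "continuous_on (sphere 0 1) (\<lambda>z. inv_into (sphere 0 1) \<psi> (\<phi> z))"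
    by (rule continuous_on_compose2[OF _ cont\<phi>]) (use \<phi>_range in blast)
  then have contk: "continuous_on (sphere 0 1) k"
    by (rule continuous_on_eq) (simp add: k \<phi>_def \<psi>_def)
  have power: "k z ^ n = blaschke_product n (\<theta> - Arg c) a z" if z: "z \<in> sphere 0 1" for z
  proof -
    have "c = cis (Arg c)"
      using c(1) rcis_cmod_Arg[of c] by (simp add: rcis_def)
    then have "cis (Arg c) * k z ^ n = blaschke_product n \<theta> a z"
      using \<psi>(2)[OF k_in[OF z]] \<psi>k[OF z] \<phi>(2)[OF z] by simp
    then have "k z ^ n = blaschke_product n \<theta> a z / cis (Arg c)"
      by (simp add: field_simps)
    then show ?thesis by (simp add: blaschke_product_def flip: cis_divide)
  qed
  show ?thesis
    using a k_in contk power by (auto simp: is_circle_root_def)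
qed

end
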